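(* Let $q$ be an odd prime power, let $d\geq 3$ be an odd divisor of $q-1$, let $b,c\in\mathbb{F}_{q^2}$ satisfy $b^{q+1}=1$ and $c^{q}=b^{q}c$, and let $e\in\mathbb{F}_{q}$ with $e\neq 0$. Then $$f(x)=\sum_{k=0}^{d-1}e(x^{q}+bx+c)^{\frac{k(q^2-1)}{d}+1}+(1-e)x^{q}-b(1+e)x$$ is a permutation polynomial of $\mathbb{F}_{q^2}$ if and only if $(1-d)^{(q^2-1)/d}=1$ in $\mathbb{F}_{q^2}$.
   Context: A polynomial is a permutation polynomial of $\mathbb{F}_{q^2}$ if the map it induces on $\mathbb{F}_{q^2}$ is a bijection. $\mathbb{F}_q$ is regarded as a subfield of $\mathbb{F}_{q^2}$, and integers are interpreted in $\mathbb{F}_{q^2}$ via the canonical ring map. *)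

theory Defs
  imports
    "HOL-Computational_Algebra.Computational_Algebra"
    "HOL-Number_Theory.Prime_Powers"
    "HOL-Library.Cardinality"
begin

definition is_subfield :: "'a::field set \<Rightarrow> bool" where
  "is_subfield K \<longleftrightarrow>
     0 \<in> K \<and> 1 \<in> K \<and>
     (\<forall>x\<in>K. \<forall>y\<in>K. x + y \<in> K \<and> x * y \<in> K) \<and>
     (\<forall>x\<in>K. - x \<in> K \<and> inverse x \<in> K)"

definition permutation_polynomial :: "'a::finite_field poly \<Rightarrow> bool" where
  "permutation_polynomial p \<longleftrightarrow> bij (poly p)"

(* The exponent is k (q^2 - 1) / d + 1; the natural-number division below is exact
   when d divides q - 1. *)
definition f_poly :: "nat \<Rightarrow> nat \<Rightarrow> 'a::field \<Rightarrow> 'a \<Rightarrow> 'a \<Rightarrow> 'a poly" where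
  "f_poly q d b c e =
     (let X = [:0, 1:] in
       (\<Sum>k = 0..d - 1. [:e:] * (X ^ q + [:b:] * X + [:c:]) ^ (k * ((q\<^sup>2 - 1) div d) + 1))
         + [:1 - e:] * X ^ q - [:b * (1 + e):] * X)"

end

theory Submission
  imports Defs "HOL-Number_Theory.Residues"
begin

text \<open>
  The values \<open>y = x\<^sup>q + b x + c\<close> and \<open>w = x\<^sup>q - b x\<close> satisfy \<open>y\<^sup>q = b\<^sup>q y\<close> and
  \<open>w\<^sup>q = - b\<^sup>q w\<close>, and \<open>x\<close> corresponds to the pair \<open>(y, w)\<close> of elements of these two
  complementary eigenspaces. In these coordinates the polynomial is
  \<open>(y, w) \<mapsto> e (g(y) + c) + w\<close>, where \<open>g(y) = \<Sum>k<d. y\<^bsup>ks+1\<^esup> - y\<close> with \<open>s = (q\<^sup>2 - 1) / d\<close>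
  stays in the first eigenspace, so it permutes the field iff \<open>g\<close> is injective there.
  Now \<open>-g\<close> multiplies \<open>y\<close> by \<open>1 - d\<close> if \<open>y\<^sup>s = 1\<close> and fixes \<open>y\<close> otherwise. Hence \<open>g\<close> is injective
  iff multiplication by \<open>1 - d\<close> preserves the condition \<open>y\<^sup>s = 1\<close>, provided that this condition
  holds for some \<open>y\<close> in the eigenspace; oddness of \<open>d\<close> is what guarantees such a \<open>y\<close>.
\<close>

section \<open>Finite field preliminaries\<close>

lemma is_subfield_power_card:
  fixes K :: "'a::field set"
  assumes K: "is_subfield K" and fin: "finite K" and x: "x \<in> K"
  shows "x ^ card K = x"
proof (cases "x = 0")
  case True
  then show ?thesis using fin x by (auto simp: power_0_left card_eq_0_iff)
next
  case False
  have mult: "u * v \<in> K" if "u \<in> K" "v \<in> K" for u v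
    using K that by (auto simp: is_subfield_def)
  have div: "u / x \<in> K" if "u \<in> K" for u
    using K x that mult by (auto simp: is_subfield_def divide_inverse)
  have "0 \<in> K" using K by (simp add: is_subfield_def)
  \<comment> \<open>Multiplication by \<open>x\<close> permutes the nonzero elements of
    \<open>K\<close>, as in Fermat's little theorem.\<close>
  have "(\<Prod>y\<in>K-{0}. x * y) = \<Prod>(K-{0})"
    by (rule prod.reindex_bij_witness[of _ "\<lambda>y. y / x" "\<lambda>y. x * y"])
       (use False x mult div in auto)
  then have "x ^ (card K - 1) * \<Prod>(K-{0}) = \<Prod>(K-{0})"
    using \<open>0 \<in> K\<close> by (simp add: prod.distrib card_Diff_singleton)
  moreover have "\<Prod>(K-{0}) \<noteq> 0" using fin by (simp add: prod_zero_iff)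
  ultimately have "x ^ (card K - 1) = 1" by simp
  moreover have "card K > 0" using fin x by (auto simp: card_gt_0_iff)
  ultimately show ?thesis by (metis mult.right_neutral power_minus_mult mult.commute)
qed

lemma CHAR_of_CARD_power:
  assumes "prime p" and "CARD('a::finite_field) = p ^ k"
  shows "CHAR('a) = p"
proof -
  have "CHAR('a) dvd p ^ k" using CHAR_dvd_CARD[where 'a='a] assms(2) by simp
  then have "CHAR('a) dvd p" by (rule prime_dvd_power[OF CHAR_prime])
  then show ?thesis using assms(1) CHAR_prime primes_dvd_imp_eq by blast
qed

lemma root_of_unity_geometric_sum:
  fixes z :: "'a::field"
  assumes "z ^ d = 1"
  shows "(\<Sum>k<d. z ^ k) = (if z = 1 then of_nat d else 0)"
  using assms by (auto simp: sum_gp_strict)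

locale unitary_twist =
  fixes q :: nat and b :: "'a::finite_field"
  assumes primepow_q: "primepow q" and odd_q: "odd q" and card_UNIV: "CARD('a) = q\<^sup>2"
    and b_norm: "b ^ (q + 1) = 1"
begin

section \<open>Frobenius and characteristic\<close>

lemma q_eq_power_CHAR: "\<exists>n>0. q = CHAR('a) ^ n"
proof -
  obtain p n where p: "prime p" "n > 0" "q = p ^ n"
    using primepow_q by (auto simp: primepow_def)
  have "CHAR('a) = p"
    using p card_UNIV by (intro CHAR_of_CARD_power[of p "n * 2"]) (auto simp: power_mult)
  then show ?thesis using p by blast
qed

lemma frobenius_add: "((x::'a) + y) ^ q = x ^ q + y ^ q"
  using q_eq_power_CHAR freshmans_dream' CHAR_prime by blast

lemma frobenius_minus: "(- (x::'a)) ^ q = - (x ^ q)"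
  using odd_q by simp

lemma frobenius_diff: "((x::'a) - y) ^ q = x ^ q - y ^ q"
  using frobenius_add[of x "- y"] frobenius_minus by simp

lemma frobenius_twice: "((x::'a) ^ q) ^ q = x"
  using finite_field_power_card_eq_same[of x] card_UNIV
  by (simp add: power2_eq_square power_mult)

lemma q_pos: "q > 0"
  using odd_q by (cases q) auto

lemma frobenius_of_nat: "(of_nat n :: 'a) ^ q = of_nat n"
  by (induction n) (use q_pos in \<open>auto simp: frobenius_add\<close>)

lemma two_neq_zero: "(2::'a) \<noteq> 0"
proof
  assume "(2::'a) = 0"
  then have "(of_nat 2 :: 'a) = 0" by simp
  then have "CHAR('a) dvd 2" by (simp only: of_nat_eq_0_iff_char_dvd)
  then have "CHAR('a) = 2" using CHAR_prime primes_dvd_imp_eq two_is_prime_nat by blast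
  then show False using q_eq_power_CHAR odd_q by auto
qed

text \<open>The characteristic divides \<open>q\<close>, so it cannot also divide
  \<open>q - 1\<close>. Later this keeps \<open>1 - of_nat d\<close> different from 1.\<close>

lemma of_nat_neq_zero_if_dvd:
  assumes "d dvd q - 1"
  shows "(of_nat d :: 'a) \<noteq> 0"
proof
  assume "(of_nat d :: 'a) = 0"
  then have "CHAR('a) dvd q - 1" using assms of_nat_eq_0_iff_char_dvd dvd_trans by blast
  moreover have "CHAR('a) dvd q" using q_eq_power_CHAR by (auto intro: dvd_power)
  ultimately have "CHAR('a) dvd q - (q - 1)" by (rule dvd_diff_nat[rotated])
  then show False using q_pos by simp
qed

lemma b_neq_zero: "b \<noteq> 0"
  using b_norm by auto

lemma bq_b: "b ^ q * b = 1"
  using b_norm by (simp add: mult.commute)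

section \<open>Splitting into Frobenius eigenspaces\<close>

definition twist :: "'a set" where
  "twist = {y. y ^ q = b ^ q * y}"

lemma twist_diff: "x \<in> twist \<Longrightarrow> y \<in> twist \<Longrightarrow> x - y \<in> twist"
  and twist_add: "x \<in> twist \<Longrightarrow> y \<in> twist \<Longrightarrow> x + y \<in> twist"
  and twist_minus: "x \<in> twist \<Longrightarrow> - x \<in> twist"
  and twist_scale: "t ^ q = t \<Longrightarrow> x \<in> twist \<Longrightarrow> t * x \<in> twist"
  by (simp_all add: twist_def frobenius_diff frobenius_add frobenius_minus
      power_mult_distrib algebra_simps)

text \<open>Frobenius is an involution and \<open>b ^ q * b = 1\<close>, so it swaps the two
  summands up to the factor \<open>b ^ q\<close>.\<close>

lemma trace_in_twist: "x ^ q + b * x \<in> twist"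
proof -
  have "(x ^ q + b * x) ^ q = (b ^ q * b) * x + b ^ q * x ^ q"
    by (simp add: frobenius_add frobenius_twice power_mult_distrib bq_b)
  then show ?thesis by (simp add: twist_def algebra_simps)
qed

lemma cotrace_frobenius: "(x ^ q - b * x) ^ q = - (b ^ q * (x ^ q - b * x))"
proof -
  have "(x ^ q - b * x) ^ q = (b ^ q * b) * x - b ^ q * x ^ q"
    by (simp add: frobenius_diff frobenius_twice power_mult_distrib bq_b)
  then show ?thesis by (simp add: algebra_simps)
qed

text \<open>The eigenvalues \<open>b ^ q\<close> and \<open>- (b ^ q)\<close> differ, since 2 and
  \<open>b\<close> are nonzero.\<close>

lemma twist_disjoint:
  assumes "z \<in> twist" and "z ^ q = - (b ^ q * z)"
  shows "z = 0"
proof -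
  have "2 * (b ^ q * z) = 0"
    using assms unfolding twist_def by (metis (mono_tags) add.right_inverse mem_Collect_eq mult_2)
  then show ?thesis using two_neq_zero b_neq_zero by simp
qed

lemma inj_decomposition_iff:
  fixes g :: "'a \<Rightarrow> 'a"
  assumes g: "\<And>y. y \<in> twist \<Longrightarrow> g y \<in> twist"
    and c: "c \<in> twist" and e: "e ^ q = e" "e \<noteq> 0"
  shows "inj (\<lambda>x. e * (g (x ^ q + b * x + c) + c) + (x ^ q - b * x)) \<longleftrightarrow> inj_on g twist"
    (is "inj ?f \<longleftrightarrow> _")
proof
  assume inj: "inj ?f"
  show "inj_on g twist"
  proof (rule inj_onI)
    fix y1 y2 assume y: "y1 \<in> twist" "y2 \<in> twist" "g y1 = g y2"
    \<comment> \<open>For \<open>y\<close> in \<open>twist\<close>, \<open>r y\<close> is the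
      preimage with second coordinate 0: it solves \<open>x ^ q + b * x + c = y\<close> and
      \<open>x ^ q - b * x = 0\<close>.\<close>
    define r where "r y = (y - c) / (2 * b)" for y
    have r: "r y ^ q = (y - c) / 2" "b * r y = (y - c) / 2" if "y \<in> twist" for y
    proof -
      have "(y - c) ^ q = b ^ q * (y - c)"
        using twist_diff[OF that c] by (simp add: twist_def)
      moreover have "(2::'a) ^ q = 2" using frobenius_of_nat[of 2] by simp
      ultimately show "r y ^ q = (y - c) / 2"
        using b_neq_zero by (simp add: r_def power_divide power_mult_distrib)
      show "b * r y = (y - c) / 2" using b_neq_zero by (simp add: r_def)
    qed
    have half: "z / 2 + z / 2 = z" for z :: 'a
      by (metis two_neq_zero add_divide_distrib mult_2 nonzero_mult_div_cancel_left)
    have y_eq: "r y ^ q + b * r y + c = y" if "y \<in> twist" for y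
      unfolding r[OF that] half by simp
    have "?f (r y) = e * (g y + c)" if "y \<in> twist" for y
      by (simp only: y_eq[OF that]) (simp add: r[OF that])
    then have "?f (r y1) = ?f (r y2)" using y by simp
    then have "r y1 = r y2" by (rule injD[OF inj])
    then show "y1 = y2" using y_eq y by metis
  qed
next
  assume inj: "inj_on g twist"
  show "inj ?f"
  proof (rule injI)
    fix x1 x2 assume eq: "?f x1 = ?f x2"
    define y w where "y x = x ^ q + b * x + c" and "w x = x ^ q - b * x" for x
    have y_twist: "y x \<in> twist" for x
      unfolding y_def by (intro twist_add trace_in_twist c)
    define z where "z = e * (g (y x1) - g (y x2))"
    have z: "z = w x2 - w x1" using eq by (simp add: z_def y_def w_def algebra_simps)
    \<comment> \<open>As a difference of \<open>g\<close>-values \<open>z\<close> lies in one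
      eigenspace, as a difference of \<open>w\<close>-values in the other.\<close>
    have "z \<in> twist" unfolding z_def by (intro twist_scale e twist_diff g y_twist)
    moreover have "z ^ q = - (b ^ q * z)"
      unfolding z w_def by (simp only: frobenius_diff[of "_ - _"] cotrace_frobenius)
        (simp add: algebra_simps)
    ultimately have "z = 0" by (rule twist_disjoint)
    then have "g (y x1) = g (y x2)" and w: "w x1 = w x2" using e z by (auto simp: z_def)
    then have "y x1 = y x2" using inj y_twist by (auto dest: inj_onD)
    \<comment> \<open>The difference \<open>y x - w x\<close> is \<open>2 * b * x + c\<close>, which
      determines \<open>x\<close>.\<close>
    then have "y x1 - w x1 = y x2 - w x2" using w by simp
    then have "2 * b * x1 = 2 * b * x2" by (simp add: y_def w_def algebra_simps)
    then show "x1 = x2" using two_neq_zero b_neq_zero by simp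
  qed
qed

text \<open>Otherwise \<open>x ^ q + b * x\<close> would vanish on all \<open>q\<^sup>2\<close>
  elements, more than its degree allows.\<close>

lemma ex_nonzero_twist: "\<exists>y\<in>twist. y \<noteq> 0"
proof (rule ccontr)
  assume "\<not> ?thesis"
  then have zero: "x ^ q + b * x = 0" for x using trace_in_twist by blast
  have q1: "q > 1" using primepow_gt_Suc_0[OF primepow_q] by simp
  define p where "p = Polynomial.monom 1 q + Polynomial.monom b 1"
  have "Polynomial.coeff p q = 1" using q1 by (simp add: p_def)
  then have "p \<noteq> 0" by auto
  moreover have "Polynomial.degree p \<le> q"
    unfolding p_def using q1 by (intro degree_add_le) (auto intro: order.trans[OF degree_monom_le])
  ultimately have "card {x. poly p x = 0} \<le> q" using card_poly_roots_bound order.trans by blast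
  moreover have "{x. poly p x = 0} = UNIV" using zero by (auto simp: p_def poly_monom)
  ultimately have "q * q \<le> q" using card_UNIV by (simp add: power2_eq_square)
  then show False using q1 by simp
qed

lemma power_card_minus_1: "x \<noteq> 0 \<Longrightarrow> (x::'a) ^ (q\<^sup>2 - 1) = 1"
proof -
  assume "x \<noteq> 0"
  have "x * x ^ (q\<^sup>2 - 1) = x ^ q\<^sup>2"
    using q_pos by (metis power_eq_if mult.commute power_not_zero not_gr_zero)
  also have "\<dots> = x * 1" using finite_field_power_card_eq_same[of x] card_UNIV by simp
  finally show ?thesis using \<open>x \<noteq> 0\<close> by simp
qed

text \<open>
  For a nonzero \<open>y\<close> in the eigenspace, \<open>a = y\<^sup>s\<close> is a \<open>d\<close>-th root of unity and the norm
  \<open>y\<^bsup>q+1\<^esup>\<close> has \<open>s\<close>-th power \<open>a\<^sup>2\<close>, because \<open>d\<close> divides \<open>q - 1\<close>. So scaling \<open>y\<close> by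
  the \<open>(d - 1) / 2\<close>-th power of its norm gives \<open>s\<close>-th power \<open>a\<^sup>d = 1\<close>.
\<close>
lemma ex_twist_power_eq_1:
  assumes d: "odd d" "d dvd q - 1" and s: "s * d = q\<^sup>2 - 1"
  shows "\<exists>y\<in>twist. y \<noteq> 0 \<and> y ^ s = 1"
proof -
  obtain y where y: "y \<in> twist" "y \<noteq> 0" using ex_nonzero_twist by blast
  obtain m where m: "d = 2 * m + 1" using d(1) by (auto elim: oddE)
  define a where "a = y ^ s"
  have ad: "a ^ d = 1" using power_card_minus_1[OF y(2)] s by (simp add: a_def flip: power_mult)
  obtain j where j: "q - 1 = d * j" using d(2) by (auto elim: dvdE)
  have "a ^ (q + 1) = a ^ (q - 1) * a\<^sup>2"
    using q_pos by (simp flip: power_add)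
  then have aq: "a ^ (q + 1) = a\<^sup>2" using ad j by (simp add: power_mult)
  define N where "N = y ^ (q + 1)"
  \<comment> \<open>The norm is fixed by Frobenius, so scaling by its powers preserves
    \<open>twist\<close>.\<close>
  have "N ^ q = (y ^ q) ^ q * y ^ q" by (simp add: N_def power_mult_distrib)
  then have Nq: "N ^ q = N" by (simp add: N_def frobenius_twice)
  have "(N ^ m) ^ q = N ^ m" by (metis Nq power_mult mult.commute)
  then have tw: "N ^ m * y \<in> twist" using y(1) by (rule twist_scale)
  have "N ^ s = a ^ (q + 1)" unfolding N_def a_def by (simp only: mult.commute flip: power_mult)
  then have "N ^ s = a\<^sup>2" using aq by (rule trans)
  moreover have "(N ^ m) ^ s = (N ^ s) ^ m" by (simp only: mult.commute flip: power_mult)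
  ultimately have "(N ^ m) ^ s = a ^ (2 * m)" by (simp only: power_mult)
  then have "(N ^ m * y) ^ s = a ^ d" by (simp add: power_mult_distrib m a_def)
  then show ?thesis using tw y(2) ad by (intro bexI[of _ "N ^ m * y"]) (auto simp: N_def)
qed

section \<open>The two-branch map on the eigenspace\<close>

definition branch :: "nat \<Rightarrow> nat \<Rightarrow> 'a \<Rightarrow> 'a" where
  "branch d s y = (if y ^ s = 1 then of_nat d - 1 else - 1) * y"

lemma branch_in_twist: "y \<in> twist \<Longrightarrow> branch d s y \<in> twist"
  unfolding branch_def using q_pos
  by (intro twist_scale) (auto simp: frobenius_diff frobenius_minus frobenius_of_nat)

text \<open>For nonzero \<open>y\<close> the ratio \<open>y ^ s\<close> is a \<open>d\<close>-th
  root of unity, so the geometric sum collapses to \<open>d\<close> or 0.\<close>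

lemma branch_sum:
  assumes "s * d = q\<^sup>2 - 1"
  shows "(\<Sum>k<d. y ^ (k * s + 1)) = branch d s y + y"
proof (cases "y = 0")
  case True
  then show ?thesis by (simp add: branch_def)
next
  case False
  have "(y ^ s) ^ d = 1" using power_card_minus_1[OF False] assms by (simp flip: power_mult)
  note root_of_unity_geometric_sum[OF this]
  moreover have "(\<Sum>k<d. y ^ (k * s + 1)) = (\<Sum>k<d. (y ^ s) ^ k) * y"
    by (simp add: sum_distrib_left mult.commute flip: power_mult)
  ultimately show ?thesis by (simp add: branch_def algebra_simps)
qed

lemma inj_on_branch_iff:
  assumes d: "odd d" "d dvd q - 1" and s: "s * d = q\<^sup>2 - 1"
  shows "inj_on (branch d s) twist \<longleftrightarrow> (1 - of_nat d :: 'a) ^ s = 1"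
proof -
  have d0: "(of_nat d :: 'a) \<noteq> 0" by (rule of_nat_neq_zero_if_dvd) fact
  have "q > 1" using primepow_gt_Suc_0[OF primepow_q] by simp
  then have "q\<^sup>2 - 1 > 0" by (simp add: power2_eq_square one_less_mult)
  then have s0: "s > 0" using s by (metis mult_is_0 not_gr_zero)
  let ?u = "1 - of_nat d :: 'a"
  have u: "?u ^ q = ?u" using q_pos by (simp add: frobenius_diff frobenius_of_nat)
  have br: "branch d s y = - (if y ^ s = 1 then ?u * y else y)" for y
    by (simp add: branch_def algebra_simps)
  show ?thesis
  proof
    assume inj: "inj_on (branch d s) twist"
    obtain y where y: "y \<in> twist" "y \<noteq> 0" "y ^ s = 1"
      using ex_twist_power_eq_1[OF d s] by blast
    show "?u ^ s = 1"
    proof (rule ccontr)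
      assume "?u ^ s \<noteq> 1"
      \<comment> \<open>Here \<open>?u * y\<close> falls in the other branch, where it is only
        negated; \<open>y\<close> is sent to the same value.\<close>
      then have "branch d s (?u * y) = branch d s y"
        using y by (simp add: br power_mult_distrib)
      then have "?u * y = y" using inj y(1) twist_scale[OF u y(1)] by (auto dest: inj_onD)
      then show False using y(2) d0 by (simp add: algebra_simps)
    qed
  next
    assume us: "?u ^ s = 1"
    then have u0: "?u \<noteq> 0" using s0 by (metis power_0_left less_numeral_extra(3) zero_neq_one)
    \<comment> \<open>The multiplier \<open>v y\<close> is unchanged when \<open>y\<close> is
      replaced by \<open>v y * y\<close>, so the image determines it and hence
      \<open>y\<close>.\<close>
    define v where "v y = (if y ^ s = 1 then ?u else 1)" for y :: 'a
    have v: "v (v y * y) = v y" "v y \<noteq> 0" for y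
      using us u0 by (simp_all add: v_def power_mult_distrib del: diff_eq_eq)
    have "branch d s y = - (v y * y)" for y by (simp add: br v_def)
    then have "y = z" if "branch d s y = branch d s z" for y z
      using that v by (metis mult_left_cancel neg_equal_iff_equal)
    then show "inj_on (branch d s) twist" by (auto intro: inj_onI)
  qed
qed

end

theorem corollary12:
  fixes q d :: nat
    and b c e :: "'a::finite_field"
    and K :: "'a set"
  assumes "primepow q" and "odd q"
    and "CARD('a) = q\<^sup>2"
    and "is_subfield K" and "card K = q"
    and "d \<ge> 3" and "odd d" and "d dvd q - 1"
    and "b ^ (q + 1) = 1" and "c ^ q = b ^ q * c"
    and "e \<in> K" and "e \<noteq> 0"
  shows "permutation_polynomial (f_poly q d b c e) \<longleftrightarrow>
           (of_int (1 - int d) :: 'a) ^ ((q\<^sup>2 - 1) div d) = 1"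
proof -
  interpret unitary_twist q b by unfold_locales fact+
  define s where "s = (q\<^sup>2 - 1) div d"
  have "q\<^sup>2 - 1 = (q - 1) * (q + 1)" by (simp add: power2_eq_square algebra_simps)
  then have "d dvd q\<^sup>2 - 1" using \<open>d dvd q - 1\<close> by (simp only: dvd_mult2)
  then have s: "s * d = q\<^sup>2 - 1" by (simp only: s_def dvd_div_mult_self)
  have e: "e ^ q = e"
    using is_subfield_power_card[OF \<open>is_subfield K\<close> _ \<open>e \<in> K\<close>] \<open>card K = q\<close> by simp
  have c: "c \<in> twist" using \<open>c ^ q = b ^ q * c\<close> by (simp add: twist_def)
  have "{0..d - 1} = {..<d}" using \<open>d \<ge> 3\<close> by auto
  then have "poly (f_poly q d b c e) x =
      e * (\<Sum>k<d. (x ^ q + b * x + c) ^ (k * s + 1)) + (1 - e) * x ^ q - b * (1 + e) * x" for x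
    by (simp add: f_poly_def s_def poly_sum sum_distrib_left Let_def algebra_simps)
  \<comment> \<open>The linear terms equal \<open>(x ^ q - b * x) - e * (x ^ q + b * x)\<close>; the
    last part cancels against the extra summand of \<open>branch_sum\<close>, leaving
    \<open>e * c\<close>.\<close>
  then have "poly (f_poly q d b c e) =
      (\<lambda>x. e * (branch d s (x ^ q + b * x + c) + c) + (x ^ q - b * x))"
    unfolding branch_sum[OF s] by (auto simp: algebra_simps)
  then have "permutation_polynomial (f_poly q d b c e) \<longleftrightarrow>
      inj (\<lambda>x. e * (branch d s (x ^ q + b * x + c) + c) + (x ^ q - b * x))"
    using finite_UNIV_inj_surj[OF finite] by (auto simp: permutation_polynomial_def bij_def)
  also have "\<dots> \<longleftrightarrow> inj_on (branch d s) twist"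
    by (rule inj_decomposition_iff) (use branch_in_twist c e \<open>e \<noteq> 0\<close> in auto)
  also have "\<dots> \<longleftrightarrow> (1 - of_nat d :: 'a) ^ s = 1"
    by (rule inj_on_branch_iff) fact+
  finally show ?thesis by (simp add: s_def)
qed

end
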